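(* Let $R=\mathbb{Z}_4[X,Y,Z]/(X^2-2,\ Y^2-2,\ Z^2,\ 2X,\ 2Y,\ 2Z,\ XY,\ XZ,\ YZ-2)$. Then $\chi(\mathbb{AG}(R))=cl(\mathbb{AG}(R))=4$.
   Context: $\mathbb{Z}_4=\mathbb{Z}/4\mathbb{Z}$. For a commutative ring $R$, an ideal $I$ is an annihilating-ideal if $\mathrm{Ann}(I)\neq(0)$. The annihilating-ideal graph $\mathbb{AG}(R)$ is the undirected simple graph whose vertices are the nonzero annihilating-ideals of $R$, where two distinct vertices $I,J$ are adjacent if and only if $IJ=(0)$. For a graph $G$, $\chi(G)$ is the chromatic number (minimal number of colors needed to color the vertices so that adjacent vertices get different colors) and $cl(G)$ is the clique number (number of vertices in a largest complete subgraph). *)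

theory Defs
  imports
    "HOL-Algebra.QuotRing"
    "HOL-Algebra.Ideal_Product"
    "HOL-Algebra.Algebraic_Closure_Type"
    "HOL-Library.Poly_Mapping"
    "HOL-Library.Numeral_Type"
    "HOL-Library.Extended_Nat"
    "HOL-Library.Ramsey"
begin

section \<open>Undirected simple graphs\<close>

text \<open>
  A graph is a pair of a vertex set and a set of two-element subsets of it.  Both invariants
  below take values in \<^typ>\<open>enat\<close>; they are \<open>\<infinity>\<close> if there is no finite colouring,
  respectively if there are finite cliques of arbitrarily large size.
\<close>

type_synonym 'a ugraph = "'a set \<times> 'a set set"

definition proper_colouring :: "'a ugraph \<Rightarrow> ('a \<Rightarrow> 'c) \<Rightarrow> bool" where
  "proper_colouring G c \<longleftrightarrow> (\<forall>u\<in>fst G. \<forall>v\<in>fst G. {u, v} \<in> snd G \<longrightarrow> c u \<noteq> c v)"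

definition chromatic_number :: "'a ugraph \<Rightarrow> enat" where
  "chromatic_number G = Inf {enat k | k. \<exists>c \<in> fst G \<rightarrow> {..<k}. proper_colouring G c}"

definition clique_number :: "'a ugraph \<Rightarrow> enat" where
  "clique_number G = Sup {enat (card K) | K. K \<subseteq> fst G \<and> finite K \<and> clique K (snd G)}"

section \<open>The annihilating-ideal graph of a commutative ring\<close>

definition annihilator :: "('a, 'b) ring_scheme \<Rightarrow> 'a set \<Rightarrow> 'a set" where
  "annihilator R I = {r \<in> carrier R. \<forall>x\<in>I. r \<otimes>\<^bsub>R\<^esub> x = \<zero>\<^bsub>R\<^esub>}"

definition annihilating_ideal :: "('a, 'b) ring_scheme \<Rightarrow> 'a set \<Rightarrow> bool" where
  "annihilating_ideal R I \<longleftrightarrow> ideal I R \<and> annihilator R I \<noteq> {\<zero>\<^bsub>R\<^esub>}"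

definition AG_verts :: "('a, 'b) ring_scheme \<Rightarrow> 'a set set" where
  "AG_verts R = {I. annihilating_ideal R I \<and> I \<noteq> {\<zero>\<^bsub>R\<^esub>}}"

definition AG :: "('a, 'b) ring_scheme \<Rightarrow> 'a set ugraph" where
  "AG R = (AG_verts R,
     {{I, J} | I J. I \<in> AG_verts R \<and> J \<in> AG_verts R \<and> I \<noteq> J \<and> I \<cdot>\<^bsub>R\<^esub> J = {\<zero>\<^bsub>R\<^esub>}})"

section \<open>The ring\<close>

text \<open>
  The numeral type \<^typ>\<open>4\<close> is the ring of integers modulo 4.  Exponent vectors of monomials
  in three indeterminates are finitely supported functions \<^typ>\<open>3 \<Rightarrow>\<^sub>0 nat\<close>, so the
  convolution ring below is the polynomial ring over the integers modulo 4 in three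
  indeterminates, which are indexed by the three elements of \<^typ>\<open>3\<close>.
\<close>

type_synonym Z4_XYZ = "(3 \<Rightarrow>\<^sub>0 nat) \<Rightarrow>\<^sub>0 4"

definition Var :: "3 \<Rightarrow> Z4_XYZ" where
  "Var i = Poly_Mapping.single (Poly_Mapping.single i 1) 1"

definition poly_ring_Z4_XYZ :: "Z4_XYZ ring" where
  "poly_ring_Z4_XYZ = ring_of_type_algebra"

definition relators :: "Z4_XYZ set" where
  "relators =
    (let x = Var 0; y = Var 1; z = Var 2
     in {x\<^sup>2 - 2, y\<^sup>2 - 2, z\<^sup>2, 2 * x, 2 * y, 2 * z, x * y, x * z, y * z - 2})"

definition R\<^sub>0 :: "Z4_XYZ set ring" where
  "R\<^sub>0 = poly_ring_Z4_XYZ Quot (Idl\<^bsub>poly_ring_Z4_XYZ\<^esub> relators)"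

end

theory Submission
  imports Defs
begin

text \<open>
  Every element of the ring is \<open>n + b X + c Y + d (Y + Z)\<close> with \<open>n\<close> modulo 4 and \<open>b, c, d\<close> modulo 2.
  It is a local ring whose maximal ideal \<open>M\<close> has square \<open>{0, 2}\<close>, and multiplication
  \<open>M / M\<^sup>2 \<times> M / M\<^sup>2 \<rightarrow> M\<^sup>2\<close> is a symmetric bilinear form on a three-dimensional space over the field
  with two elements. The elements \<open>X\<close>, \<open>Y\<close>, \<open>Y + Z\<close> form an orthonormal basis, so this form is the
  standard dot product. It is nondegenerate, so every nonzero ideal contains 2. Thus the vertices
  of the graph are the subspaces of \<open>M / M\<^sup>2\<close>, and two distinct ones are adjacent if and only if they
  are orthogonal.

  The zero subspace and the three lines spanned by the basis are a clique of size 4. Conversely, the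
  zero subspace gets a colour of its own, and any other subspace gets the colour of one of its
  nonzero vectors in a colouring of vectors with three colours in which distinct orthogonal vectors
  have different colours (\<open>vector_colour_proper\<close>). If anisotropic vectors are preferred as
  representatives, this is a proper colouring (\<open>colour_proper\<close>), so four colours suffice. As the
  clique number is at most the chromatic number, both are 4.

  That the quotient really has this form rests on 2 being nonzero in it
  (\<open>two_notin_relation_ideal\<close>). A linear functional on polynomials witnesses this: it vanishes on
  all multiples of the relators but not at 2. The nondegeneracy of the form then gives the
  uniqueness of coordinates (\<open>residue_normal_form_eq_zero_iff\<close>).
\<close>

section \<open>Cliques and colourings\<close>

lemma clique_number_le_chromatic_number: "clique_number G \<le> chromatic_number G"
  unfolding clique_number_def chromatic_number_def
proof (intro Sup_least Inf_greatest, clarify)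
  fix K and k :: nat and c
  assume K: "K \<subseteq> fst G" "finite K" "clique K (snd G)"
    and c: "c \<in> fst G \<rightarrow> {..<k}" "proper_colouring G c"
  have "inj_on c K"
    using K c(2) unfolding inj_on_def proper_colouring_def clique_def by blast
  moreover have "c ` K \<subseteq> {..<k}"
    using K(1) c(1) by auto
  ultimately have "card K \<le> k"
    using card_inj_on_le[of c K "{..<k}"] by simp
  then show "enat (card K) \<le> enat k"
    by simp
qed

section \<open>Products of ideals\<close>

lemma (in ring) ideal_prod_eq_zero_iff:
  assumes "ideal I R" "ideal J R"
  shows "I \<cdot> J = {\<zero>} \<longleftrightarrow> (\<forall>a\<in>I. \<forall>b\<in>J. a \<otimes> b = \<zero>)"
proof
  assume "I \<cdot> J = {\<zero>}"
  then show "\<forall>a\<in>I. \<forall>b\<in>J. a \<otimes> b = \<zero>"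
    using ideal_prod.prod[of _ I _ J R] by blast
next
  assume prods: "\<forall>a\<in>I. \<forall>b\<in>J. a \<otimes> b = \<zero>"
  have "s = \<zero>" if "s \<in> I \<cdot> J" for s
    using that by induction (use prods in auto)
  moreover have "\<zero> \<in> I \<cdot> J"
    by (intro additive_subgroup.zero_closed ideal.axioms(1) ideal_prod_is_ideal assms)
  ultimately show "I \<cdot> J = {\<zero>}"
    by blast
qed

lemma (in cring) principal_ideal_prod_eq_zero:
  assumes "a \<in> carrier R" "b \<in> carrier R" "a \<otimes> b = \<zero>"
  shows "(PIdl a) \<cdot> (PIdl b) = {\<zero>}"
proof -
  have "(r \<otimes> a) \<otimes> (s \<otimes> b) = (r \<otimes> s) \<otimes> (a \<otimes> b)"
    if "r \<in> carrier R" "s \<in> carrier R" for r s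
    using that assms(1,2) by algebra
  then have "(r \<otimes> a) \<otimes> (s \<otimes> b) = \<zero>" if "r \<in> carrier R" "s \<in> carrier R" for r s
    using that assms(3) by simp
  then show ?thesis
    unfolding ideal_prod_eq_zero_iff[OF cgenideal_ideal[OF assms(1)] cgenideal_ideal[OF assms(2)]]
    by (auto simp: cgenideal_def)
qed

lemma (in cring) principal_ideal_in_AG_verts:
  assumes "a \<in> carrier R" "a \<noteq> \<zero>" "r \<in> carrier R" "r \<noteq> \<zero>" "r \<otimes> a = \<zero>"
  shows "PIdl a \<in> AG_verts R"
proof -
  have "r \<otimes> (s \<otimes> a) = s \<otimes> (r \<otimes> a)" if "s \<in> carrier R" for s
    using that assms(1,3) by algebra
  then have "r \<in> annihilator R (PIdl a)"
    using assms by (auto simp: annihilator_def cgenideal_def)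
  moreover have "a \<in> PIdl a"
    by (rule cgenideal_self) fact
  ultimately show ?thesis
    using assms cgenideal_ideal unfolding AG_verts_def annihilating_ideal_def by blast
qed

section \<open>Colouring the nonzero vectors over the two-element field\<close>

text \<open>
  Vectors over the two-element field are written with integer entries that matter only modulo 2,
  so \<open>u\<close> and \<open>v\<close> are orthogonal if \<open>dot u v\<close> is even, and isotropic vectors are those with
  \<open>dot v v\<close> even.
\<close>

type_synonym vector = "int \<times> int \<times> int"

definition nonzero_vectors :: "vector set" where
  "nonzero_vectors = {(1,0,0), (0,1,0), (0,0,1), (1,1,0), (1,0,1), (0,1,1), (1,1,1)}"

fun dot :: "vector \<Rightarrow> vector \<Rightarrow> int" where
  "dot (b, c, d) (b', c', d') = b * b' + c * c' + d * d'"

text \<open>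
  With \<open>e\<^sub>1, e\<^sub>2, e\<^sub>3\<close> the standard basis, the colour classes are
  \<open>{e\<^sub>1, e\<^sub>1 + e\<^sub>2, e\<^sub>1 + e\<^sub>3}\<close>, \<open>{e\<^sub>2, e\<^sub>2 + e\<^sub>3}\<close> and \<open>{e\<^sub>3, e\<^sub>1 + e\<^sub>2 + e\<^sub>3}\<close>; within each
  class no two distinct vectors are orthogonal. The orthonormal basis forces at least three
  colours.
\<close>

definition vector_colour :: "vector \<Rightarrow> nat" where
  "vector_colour v =
    (if v \<in> {(1,0,0), (1,1,0), (1,0,1)} then 0 else if v \<in> {(0,1,0), (0,1,1)} then 1 else 2)"

lemma vector_colour_proper:
  assumes "u \<in> nonzero_vectors" "v \<in> nonzero_vectors" "u \<noteq> v" "even (dot u v)"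
  shows "vector_colour u \<noteq> vector_colour v"
  using assms by (auto simp: nonzero_vectors_def vector_colour_def)

text \<open>
  The isotropic vectors are the three \<open>e\<^sub>i + e\<^sub>j\<close>, and two different ones share exactly one basis
  vector. This is what makes the choice of representatives below work when two ideals have the
  same representative.
\<close>

lemma isotropic_orthogonal_imp_eq:
  assumes "u \<in> nonzero_vectors" "v \<in> nonzero_vectors"
    and "even (dot u u)" "even (dot v v)" "even (dot u v)"
  shows "u = v"
  using assms by (auto simp: nonzero_vectors_def)

section \<open>Local rings with the dot product as multiplication\<close>

text \<open>
  An axiomatic description of the ring in question by coordinates. \<open>N n b c d\<close> stands for
  \<open>n + b e\<^sub>1 + c e\<^sub>2 + d e\<^sub>3\<close>, where \<open>n\<close> matters modulo 4 and \<open>b, c, d\<close> modulo 2; integer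
  coordinates make the lift \<open>2 * (b * b' + c * c' + d * d')\<close> of the dot product to the integers
  modulo 4 an ordinary expression. The maximal ideal consists of the elements with \<open>n\<close> even, and
  its square is the socle \<open>{0, N 2 0 0 0}\<close>.
\<close>

locale dot_product_ring = cring R for R (structure) +
  fixes N :: "int \<Rightarrow> int \<Rightarrow> int \<Rightarrow> int \<Rightarrow> 'a"
  assumes N_closed: "N n b c d \<in> carrier R"
    and N_cases: "x \<in> carrier R \<Longrightarrow> \<exists>n b c d. x = N n b c d"
    and N_add: "N n b c d \<oplus> N n' b' c' d' = N (n + n') (b + b') (c + c') (d + d')"
    and N_mult: "N n b c d \<otimes> N n' b' c' d' =
      N (n * n' + 2 * (b * b' + c * c' + d * d')) (n * b' + n' * b) (n * c' + n' * c) (n * d' + n' * d)"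
    and N_eq_zero_iff: "N n b c d = \<zero> \<longleftrightarrow> 4 dvd n \<and> even b \<and> even c \<and> even d"
begin

lemma N_eqI:
  assumes "4 dvd n - n'" "even (b - b')" "even (c - c')" "even (d - d')"
  shows "N n b c d = N n' b' c' d'"
proof -
  have "N n b c d = N n' b' c' d' \<oplus> N (n - n') (b - b') (c - c') (d - d')"
    by (simp add: N_add)
  also have "N (n - n') (b - b') (c - c') (d - d') = \<zero>"
    using assms by (simp add: N_eq_zero_iff)
  finally show ?thesis
    by (simp add: N_closed)
qed

lemma N_eq_iff:
  "N n b c d = N n' b' c' d' \<longleftrightarrow>
    4 dvd n - n' \<and> even (b - b') \<and> even (c - c') \<and> even (d - d')"
proof
  assume eq: "N n b c d = N n' b' c' d'"
  have "N (n - n') (b - b') (c - c') (d - d') = N n b c d \<oplus> N (- n') (- b') (- c') (- d')"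
    by (simp add: N_add)
  also have "\<dots> = \<zero>"
    by (simp add: eq N_add N_eq_zero_iff)
  finally show "4 dvd n - n' \<and> even (b - b') \<and> even (c - c') \<and> even (d - d')"
    by (simp add: N_eq_zero_iff)
qed (simp add: N_eqI)

lemma ideal_N_add:
  assumes "ideal I R" "N n b c d \<in> I" "N n' b' c' d' \<in> I"
  shows "N (n + n') (b + b') (c + c') (d + d') \<in> I"
  using additive_subgroup.a_closed[OF ideal.axioms(1)[OF assms(1)] assms(2,3)] by (simp add: N_add)

lemma ideal_N_mult:
  assumes "ideal I R" "N n b c d \<in> I"
  shows "N (n * n' + 2 * (b * b' + c * c' + d * d')) (n * b' + n' * b) (n * c' + n' * c) (n * d' + n' * d) \<in> I"
  using ideal.I_r_closed[OF assms N_closed] by (simp add: N_mult)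

text \<open>
  The pairing of the ring with itself into the socle is nondegenerate: every nonzero element can
  be multiplied to \<open>N 2 0 0 0\<close>, a unit by \<open>N 2 0 0 0\<close> itself, an element of the maximal ideal
  outside the socle by the basis vector at an odd entry, and \<open>N 2 0 0 0\<close> by a unit.
\<close>

lemma socle_in_nonzero_ideal:
  assumes I: "ideal I R" "I \<noteq> {\<zero>}"
  shows "N 2 0 0 0 \<in> I"
proof -
  have "\<zero> \<in> I"
    using I(1) by (simp add: additive_subgroup.zero_closed ideal.axioms(1))
  then obtain x where x: "x \<in> I" "x \<noteq> \<zero>"
    using I(2) by blast
  then obtain n b c d where N: "x = N n b c d"
    using N_cases ideal.Icarr[OF I(1)] by blast
  have mult: "N (n * n' + 2 * (b * b' + c * c' + d * d')) (n * b' + n' * b) (n * c' + n' * c) (n * d' + n' * d) \<in> I"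
    for n' b' c' d'
    using ideal_N_mult[OF I(1)] x(1) N by simp
  have four: "4 dvd 2 * k - 2" if "odd k" for k :: int
    using that by presburger
  consider "odd n" | "even n" "odd b" | "even n" "odd c" | "even n" "odd d"
    | "even n" "even b" "even c" "even d"
    by blast
  then show ?thesis
  proof cases
    case 1
    then have "N (n * 2) (2 * b) (2 * c) (2 * d) = N 2 0 0 0"
      using four[of n] by (intro N_eqI) (auto simp: mult.commute)
    with mult[of 2 0 0 0] show ?thesis by simp
  next
    case 2
    then have "N (2 * b) n 0 0 = N 2 0 0 0"
      using four[of b] by (intro N_eqI) auto
    with mult[of 0 1 0 0] show ?thesis by simp
  next
    case 3
    then have "N (2 * c) 0 n 0 = N 2 0 0 0"
      using four[of c] by (intro N_eqI) auto
    with mult[of 0 0 1 0] show ?thesis by simp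
  next
    case 4
    then have "N (2 * d) 0 0 n = N 2 0 0 0"
      using four[of d] by (intro N_eqI) auto
    with mult[of 0 0 0 1] show ?thesis by simp
  next
    case 5
    then have "\<not> 4 dvd n"
      using x(2) N N_eq_zero_iff by blast
    with \<open>even n\<close> have "4 dvd n - 2"
      by presburger
    then have "x = N 2 0 0 0"
      unfolding N using 5 by (intro N_eqI) auto
    with x(1) show ?thesis by simp
  qed
qed

text \<open>
  Proper nonzero ideals contain the socle, so they are unions of its cosets in the maximal ideal.
  They therefore correspond to subspaces of the quotient of the maximal ideal by the socle.
\<close>

lemma proper_ideal_determined_by_vectors:
  assumes I: "ideal I R" "N 2 0 0 0 \<in> I" "\<And>n b c d. N n b c d \<in> I \<Longrightarrow> even n"
    and J: "ideal J R" "N 2 0 0 0 \<in> J"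
    and sub: "\<And>b c d. (b, c, d) \<in> nonzero_vectors \<Longrightarrow> N 0 b c d \<in> I \<Longrightarrow> N 0 b c d \<in> J"
  shows "I \<subseteq> J"
proof
  have shift: "N m b c d \<in> L"
    if L: "ideal L R" "N 2 0 0 0 \<in> L" "N n b c d \<in> L" and "even (m - n)" for L m n b c d
  proof -
    from \<open>even (m - n)\<close> have "4 dvd m - n \<or> 4 dvd m - (n + 2)"
      by presburger
    then consider "4 dvd m - n" | "4 dvd m - (n + 2)"
      by blast
    then show ?thesis
    proof cases
      case 1
      then have "N m b c d = N n b c d" by (intro N_eqI) auto
      with L show ?thesis by simp
    next
      case 2
      then have "N m b c d = N (n + 2) b c d" by (intro N_eqI) auto
      with ideal_N_add[OF L(1,3,2)] show ?thesis by simp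
    qed
  qed
  fix x assume "x \<in> I"
  then obtain n b c d where x: "x = N n b c d"
    using N_cases ideal.Icarr[OF I(1)] by blast
  have "even n"
    using I(3) \<open>x \<in> I\<close> x by simp
  \<comment> \<open>The index set of vectors uses the representatives 0 and 1 of the residues modulo 2.\<close>
  have red: "N m b c d = N m (b mod 2) (c mod 2) (d mod 2)" for m
    by (intro N_eqI) auto
  have "N 0 (b mod 2) (c mod 2) (d mod 2) \<in> I"
    using shift[OF I(1,2), of n b c d 0] \<open>even n\<close> \<open>x \<in> I\<close> x red by simp
  moreover have "(b mod 2, c mod 2, d mod 2) \<in> insert (0, 0, 0) nonzero_vectors"
    unfolding nonzero_vectors_def by (auto simp: mod2_eq_if)
  moreover have "N 0 0 0 0 \<in> J"
    using shift[OF J(1,2,2), of 0] by simp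
  ultimately have "N 0 (b mod 2) (c mod 2) (d mod 2) \<in> J"
    using sub by auto
  then show "x \<in> J"
    using shift[OF J, of 0 _ _ _ n] \<open>even n\<close> x red[of n] by simp
qed

definition vectors :: "'a set \<Rightarrow> vector set" where
  "vectors I = {(b, c, d) \<in> nonzero_vectors. N 0 b c d \<in> I}"

text \<open>
  The representative of an ideal is anisotropic whenever the ideal contains an anisotropic vector.
  This preference is essential: the plane orthogonal to an isotropic \<open>v\<close> contains \<open>v\<close>, and
  choosing \<open>v\<close> for it would give it the colour of the adjacent line spanned by \<open>v\<close>.
\<close>

definition representative :: "'a set \<Rightarrow> vector" where
  "representative I =
    (SOME v. v \<in> vectors I \<and> (even (dot v v) \<longrightarrow> (\<forall>u\<in>vectors I. even (dot u u))))"

text \<open>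
  The fourth colour serves the socle alone, which is adjacent to every other vertex.
\<close>

definition colour :: "'a set \<Rightarrow> nat" where
  "colour I = (if vectors I = {} then 3 else vector_colour (representative I))"

lemma representative:
  assumes "vectors I \<noteq> {}"
  shows "representative I \<in> vectors I"
    and "even (dot (representative I) (representative I)) \<Longrightarrow> u \<in> vectors I \<Longrightarrow> even (dot u u)"
proof -
  have "\<exists>v. v \<in> vectors I \<and> (even (dot v v) \<longrightarrow> (\<forall>u\<in>vectors I. even (dot u u)))"
    using assms by blast
  note rep = someI_ex[OF this, folded representative_def]
  show "representative I \<in> vectors I"
    using rep by blast
  show "even (dot (representative I) (representative I)) \<Longrightarrow> u \<in> vectors I \<Longrightarrow> even (dot u u)"
    using rep by blast
qed

text \<open>
  Let \<open>I\<close> and \<open>J\<close> be adjacent, with the same colour. If one of them is the socle then so is the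
  other. Otherwise their representatives are orthogonal vectors of the same colour, hence equal
  to some \<open>v\<close>, which is orthogonal to itself. By the choice of representatives all vectors of \<open>I\<close>
  and of \<open>J\<close> are then isotropic, and they are orthogonal to \<open>v\<close>, so they equal \<open>v\<close>. In each case
  \<open>I\<close> and \<open>J\<close> have the same vectors, so \<open>I = J\<close>.
\<close>

lemma colour_proper: "proper_colouring (AG R) colour"
  unfolding proper_colouring_def
proof (intro ballI impI notI)
  fix I J
  assume V: "I \<in> fst (AG R)" "J \<in> fst (AG R)" and E: "{I, J} \<in> snd (AG R)"
    and col: "colour I = colour J"
  have I: "ideal I R" "I \<noteq> {\<zero>}" and J: "ideal J R" "J \<noteq> {\<zero>}"
    using V by (auto simp: AG_def AG_verts_def annihilating_ideal_def)
  have "I \<noteq> J" and "I \<cdot> J = {\<zero>} \<or> J \<cdot> I = {\<zero>}"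
    using E by (auto simp: AG_def doubleton_eq_iff)
  then have prods: "x \<otimes> y = \<zero>" if "x \<in> I" "y \<in> J" for x y
    using that I(1) J(1) m_comm[OF ideal.Icarr[OF I(1)] ideal.Icarr[OF J(1)]]
    by (metis ideal_prod_eq_zero_iff)
  note tI = socle_in_nonzero_ideal[OF I] and tJ = socle_in_nonzero_ideal[OF J]
  \<comment> \<open>Multiplication by the socle element of the other ideal shows that neither ideal contains a unit.\<close>
  have evenI: "even n" if "N n b c d \<in> I" for n b c d
    using prods[OF that tJ] by (simp add: N_mult N_eq_zero_iff) presburger
  have evenJ: "even n" if "N n b c d \<in> J" for n b c d
    using prods[OF tI that] by (simp add: N_mult N_eq_zero_iff) presburger
  have orth: "even (dot u v)" if "u \<in> vectors I" "v \<in> vectors J" for u v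
  proof -
    obtain b c d b' c' d' where uv: "u = (b, c, d)" "v = (b', c', d')"
      by (metis prod_cases3)
    then have "N (2 * dot u v) 0 0 0 = \<zero>"
      using prods[of "N 0 b c d" "N 0 b' c' d'"] that by (simp add: vectors_def N_mult)
    then have "4 dvd 2 * dot u v"
      unfolding N_eq_zero_iff by blast
    then show ?thesis
      by presburger
  qed
  have nonzero: "vectors L \<subseteq> nonzero_vectors" for L
    by (auto simp: vectors_def)
  have empty_iff: "vectors I = {} \<longleftrightarrow> vectors J = {}"
    using col by (auto simp: colour_def vector_colour_def split: if_splits)
  have "vectors I = vectors J"
  proof (cases "vectors I = {}")
    case False
    then have "vectors J \<noteq> {}"
      using empty_iff by blast
    define v where "v = representative I"
    have vI: "v \<in> vectors I" and isoI: "\<And>u. even (dot v v) \<Longrightarrow> u \<in> vectors I \<Longrightarrow> even (dot u u)"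
      using representative[OF False] unfolding v_def by blast+
    have "v = representative J"
    proof (rule ccontr)
      assume "v \<noteq> representative J"
      moreover have "representative J \<in> vectors J"
        using representative(1) \<open>vectors J \<noteq> {}\<close> .
      ultimately have "vector_colour v \<noteq> vector_colour (representative J)"
        using vI orth nonzero by (intro vector_colour_proper) blast+
      then show False
        using col False \<open>vectors J \<noteq> {}\<close> by (simp add: colour_def v_def)
    qed
    then have vJ: "v \<in> vectors J" and isoJ: "\<And>u. even (dot v v) \<Longrightarrow> u \<in> vectors J \<Longrightarrow> even (dot u u)"
      using representative[OF \<open>vectors J \<noteq> {}\<close>] by blast+
    have "even (dot v v)"
      by (rule orth[OF vI vJ])
    have "u = v" if "u \<in> vectors I" for u
      using that isoI orth[OF that vJ] \<open>even (dot v v)\<close> nonzero vI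
      by (intro isotropic_orthogonal_imp_eq) blast+
    moreover have "v = u" if "u \<in> vectors J" for u
      using that isoJ orth[OF vI that] \<open>even (dot v v)\<close> nonzero vI
      by (intro isotropic_orthogonal_imp_eq) blast+
    ultimately show ?thesis
      using vI vJ by blast
  qed (use empty_iff in blast)
  then have iff: "N 0 b c d \<in> I \<longleftrightarrow> N 0 b c d \<in> J" if "(b, c, d) \<in> nonzero_vectors" for b c d
    using that unfolding vectors_def by blast
  have "I \<subseteq> J"
    by (rule proper_ideal_determined_by_vectors[OF I(1) tI evenI J(1) tJ]) (use iff in auto)
  moreover have "J \<subseteq> I"
    by (rule proper_ideal_determined_by_vectors[OF J(1) tJ evenJ I(1) tI]) (use iff in auto)
  ultimately show False
    using \<open>I \<noteq> J\<close> by blast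
qed

lemma chromatic_number_le_4: "chromatic_number (AG R) \<le> 4"
proof -
  have "colour \<in> fst (AG R) \<rightarrow> {..<4}"
    by (auto simp: colour_def vector_colour_def)
  then have "chromatic_number (AG R) \<le> enat 4"
    unfolding chromatic_number_def using colour_proper by (intro Inf_lower) blast
  then show ?thesis
    by (simp add: numeral_eq_enat)
qed

text \<open>
  The clique consists of the socle and the three ideals generated by the basis vectors: their
  generators annihilate each other because the basis is orthogonal.
\<close>

lemma clique_number_ge_4: "4 \<le> clique_number (AG R)"
proof -
  define A where "A = {N 2 0 0 0, N 0 1 0 0, N 0 0 1 0, N 0 0 0 1}"
  have A: "a \<in> carrier R" "a \<noteq> \<zero>" "N 2 0 0 0 \<otimes> a = \<zero>" if "a \<in> A" for a
    using that by (auto simp: A_def N_closed N_mult N_eq_zero_iff eq_commute[of "\<zero>"])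
  have orth: "a \<otimes> b = \<zero>" if "a \<in> A" "b \<in> A" "a \<noteq> b" for a b
    using that by (auto simp: A_def N_mult N_eq_zero_iff)
  have not_mem: "a \<notin> PIdl b" if ab: "a \<in> A" "b \<in> A" "a \<noteq> b" and "a \<noteq> N 2 0 0 0" for a b
  proof
    assume "a \<in> PIdl b"
    then obtain n x y z where "a = N n x y z \<otimes> b"
      unfolding cgenideal_def using N_cases by blast
    then show False
      using that by (auto simp: A_def N_mult N_eq_iff)
  qed
  have inj: "inj_on (cgenideal R) A"
  proof (rule inj_onI, rule ccontr)
    fix a b assume ab: "a \<in> A" "b \<in> A" "PIdl a = PIdl b" "a \<noteq> b"
    then have "a \<in> PIdl b" "b \<in> PIdl a"
      using cgenideal_self A(1) by blast+
    with not_mem[of a b] not_mem[of b a] ab show False by auto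
  qed
  have "card A = 4"
    by (simp add: A_def N_eq_iff)
  have V: "PIdl a \<in> AG_verts R" if "a \<in> A" for a
    using principal_ideal_in_AG_verts[of a "N 2 0 0 0"] A[OF that]
    by (auto simp: N_closed N_eq_zero_iff)
  have "clique (cgenideal R ` A) (snd (AG R))"
    unfolding clique_def
  proof (intro ballI impI)
    fix I J assume "I \<in> cgenideal R ` A" "J \<in> cgenideal R ` A" "I \<noteq> J"
    then obtain a b where "a \<in> A" "b \<in> A" "a \<noteq> b" "I = PIdl a" "J = PIdl b"
      by blast
    then have "I \<in> AG_verts R" "J \<in> AG_verts R" "I \<cdot> J = {\<zero>}"
      using V principal_ideal_prod_eq_zero[OF A(1) A(1) orth] by simp_all
    with \<open>I \<noteq> J\<close> show "{I, J} \<in> snd (AG R)"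
      unfolding AG_def snd_conv by blast
  qed
  then have "enat (card (cgenideal R ` A)) \<le> clique_number (AG R)"
    unfolding clique_number_def
    by (intro Sup_upper CollectI exI[of _ "cgenideal R ` A"]) (use V in \<open>auto simp: AG_def A_def\<close>)
  then show ?thesis
    using card_image[OF inj] \<open>card A = 4\<close> by (simp add: numeral_eq_enat)
qed

end

section \<open>Polynomials in three variables over the integers modulo 4\<close>

abbreviation "lookup \<equiv> Poly_Mapping.lookup"
abbreviation "single \<equiv> Poly_Mapping.single"

lemma ideal_ring_of_type_algebraI:
  fixes I :: "'a :: comm_ring_1 set"
  assumes zero: "0 \<in> I" and add: "\<And>x y. x \<in> I \<Longrightarrow> y \<in> I \<Longrightarrow> x + y \<in> I"
    and mult: "\<And>x r. x \<in> I \<Longrightarrow> r * x \<in> I"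
  shows "ideal I ring_of_type_algebra"
proof -
  interpret P: cring "ring_of_type_algebra :: 'a ring"
    by (rule cring_from_type_algebra)
  have neg: "inv\<^bsub>add_monoid ring_of_type_algebra\<^esub> x = - x" for x :: 'a
    unfolding a_inv_def[symmetric]
    by (rule P.minus_equality) (auto simp: ring_of_type_algebra_def)
  show ?thesis
  proof (rule idealI)
    show "ring (ring_of_type_algebra :: 'a ring)"
      by (rule P.ring_axioms)
    show "subgroup I (add_monoid ring_of_type_algebra)"
    proof (rule subgroup.intro)
      show "inv\<^bsub>add_monoid ring_of_type_algebra\<^esub> x \<in> I" if "x \<in> I" for x
        unfolding neg using mult[OF that, of "- 1"] by simp
    qed (use zero add in \<open>auto simp: ring_of_type_algebra_def\<close>)
  qed (use mult in \<open>auto simp: ring_of_type_algebra_def mult.commute\<close>)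
qed

lemma poly_mapping_monomial_induct [case_names zero single add]:
  fixes p :: "'a \<Rightarrow>\<^sub>0 'b :: comm_monoid_add"
  assumes zero: "P 0" and single: "\<And>k c. P (single k c)"
    and add: "\<And>p q. P p \<Longrightarrow> P q \<Longrightarrow> P (p + q)"
  shows "P p"
proof (induction p rule: update_induct)
  case const
  show ?case by (rule zero)
next
  case (update f a b)
  have "Poly_Mapping.update a b f = single a b + f"
    using update(1) by (intro poly_mapping_eqI)
      (auto simp: lookup_update lookup_add lookup_single in_keys_iff)
  then show ?case
    using add[OF single update(3)] by simp
qed

lemma three_cases: "i = 0 \<or> i = 1 \<or> i = 2" for i :: 3
proof (cases i)
  case (of_int z)
  then have "z = 0 \<or> z = 1 \<or> z = 2"
    by auto
  with of_int show ?thesis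
    by auto
qed

lemma exponent_eq_iff:
  fixes k l :: "3 \<Rightarrow>\<^sub>0 nat"
  shows "k = l \<longleftrightarrow> lookup k 0 = lookup l 0 \<and> lookup k 1 = lookup l 1 \<and> lookup k 2 = lookup l 2"
proof
  assume eq: "lookup k 0 = lookup l 0 \<and> lookup k 1 = lookup l 1 \<and> lookup k 2 = lookup l 2"
  show "k = l"
  proof (rule poly_mapping_eqI)
    show "lookup k i = lookup l i" for i
      using three_cases[of i] eq by blast
  qed
qed simp

lemma Var_power: "Var i ^ n = single (single i n) 1"
  by (induction n) (simp_all add: Var_def mult_single flip: single_add)

lemma Z4_XYZ_induct [case_names const Var add mult]:
  fixes p :: Z4_XYZ
  assumes const: "\<And>n :: int. P (of_int n)" and Var: "\<And>i. P (Var i)"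
    and add: "\<And>p q. P p \<Longrightarrow> P q \<Longrightarrow> P (p + q)"
    and mult: "\<And>p q. P p \<Longrightarrow> P q \<Longrightarrow> P (p * q)"
  shows "P p"
proof (induction p rule: poly_mapping_monomial_induct)
  case zero
  show ?case using const[of 0] by simp
next
  case (single k c)
  have power: "P (Var i ^ n)" for i n
    using const[of 1] by (induction n) (auto intro: Var mult)
  have "P (single k 1)"
  proof (induction k rule: poly_mapping_monomial_induct)
    case zero
    show ?case using const[of 1] by simp
  next
    case (single i n)
    show ?case using power[of i n] by (simp add: Var_power)
  next
    case (add k l)
    then show ?case
      using mult[OF add] by (simp add: mult_single)
  qed
  moreover obtain n where "c = of_int n"
    by (cases c)
  moreover have "single k (of_int n) = of_int n * single k (1 :: 4)" for n
    by (simp add: mult_single flip: single_of_int)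
  ultimately show ?case
    using mult[OF const] by simp
qed (rule add)

section \<open>The ideal of relations does not contain 2\<close>

text \<open>
  The functional is the Macaulay dual generator of the ideal of relations. It is found by
  reducing monomials: 1 is sent to itself, \<open>X\<^sup>2\<close>, \<open>Y\<^sup>2\<close> and \<open>Y Z\<close> must have the value of 2, and all
  other monomials have value 0.
\<close>

definition socle_functional :: "Z4_XYZ \<Rightarrow> 4" where
  "socle_functional p = lookup p 0 +
    2 * (lookup p (single 0 2) + lookup p (single 1 2) + lookup p (single 1 1 + single 2 1))"

lemma socle_functional_add: "socle_functional (p + q) = socle_functional p + socle_functional q"
  by (simp add: socle_functional_def lookup_add algebra_simps)

text \<open>
  By additivity \<open>q\<close> may be taken to be a term \<open>c m\<close> with \<open>m\<close> a monomial, and then only the few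
  monomials with nonzero weight can contribute. For instance \<open>X\<^sup>2 - 2\<close> times \<open>c m\<close> has value
  \<open>2 c - 2 c\<close> for \<open>m = 1\<close> and \<open>- 2 (2 c) = 0\<close> for \<open>m\<close> one of \<open>X\<^sup>2, Y\<^sup>2, Y Z\<close>.
\<close>

lemma socle_functional_mult_relator:
  assumes "r \<in> relators"
  shows "socle_functional (q * r) = 0"
proof (induction q rule: poly_mapping_monomial_induct)
  case zero
  show ?case by (simp add: socle_functional_def)
next
  case (single k c)
  \<comment> \<open>Constants are single terms with exponent 0, so that products of terms can be computed.\<close>
  have num: "(2 :: Z4_XYZ) = single 0 2"
    by simp
  have "(4 :: 4) = 0"
    by simp
  then have four: "4 * c = 0"
    by (rule ssubst) simp
  consider "r = Var 0 ^ 2 - 2" | "r = Var 1 ^ 2 - 2" | "r = Var 2 ^ 2"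
    | "r = 2 * Var 0" | "r = 2 * Var 1" | "r = 2 * Var 2"
    | "r = Var 0 * Var 1" | "r = Var 0 * Var 2" | "r = Var 1 * Var 2 - 2"
    using assms by (auto simp: relators_def Let_def)
  then show ?case
    by cases (simp_all add: socle_functional_def power2_eq_square Var_def num mult_single lookup_minus right_diff_distrib
       lookup_single exponent_eq_iff lookup_add when_def four del: single_numeral)
next
  case (add p q)
  then show ?case
    by (simp add: distrib_right socle_functional_add)
qed

abbreviation relation_ideal :: "Z4_XYZ set" where
  "relation_ideal \<equiv> Idl\<^bsub>poly_ring_Z4_XYZ\<^esub> relators"

lemma cring_poly_ring: "cring poly_ring_Z4_XYZ"
  unfolding poly_ring_Z4_XYZ_def by (rule cring_from_type_algebra)

lemma poly_ring_simps [simp]: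
  "carrier poly_ring_Z4_XYZ = UNIV" "\<zero>\<^bsub>poly_ring_Z4_XYZ\<^esub> = 0"
  "x \<oplus>\<^bsub>poly_ring_Z4_XYZ\<^esub> y = x + y" "x \<otimes>\<^bsub>poly_ring_Z4_XYZ\<^esub> y = x * y"
  by (simp_all add: poly_ring_Z4_XYZ_def ring_of_type_algebra_def)

lemma ideal_relation_ideal: "ideal relation_ideal poly_ring_Z4_XYZ"
  using ring.genideal_ideal[OF cring.axioms(1)[OF cring_poly_ring]] by simp

text \<open>
  The polynomials all of whose multiples are killed by the functional form an ideal containing the
  relators, hence the ideal of relations; but the functional takes the nonzero value 2 at 2.
\<close>

lemma two_notin_relation_ideal: "2 \<notin> relation_ideal"
proof
  define J where "J = {p. \<forall>q. socle_functional (q * p) = 0}"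
  have "ideal J poly_ring_Z4_XYZ"
    unfolding poly_ring_Z4_XYZ_def
  proof (rule ideal_ring_of_type_algebraI)
    show "0 \<in> J"
      by (simp add: J_def socle_functional_def)
    show "x + y \<in> J" if "x \<in> J" "y \<in> J" for x y
      using that by (simp add: J_def distrib_left socle_functional_add)
    show "r * x \<in> J" if "x \<in> J" for x r
      using that by (simp add: J_def flip: mult.assoc)
  qed
  moreover have "relators \<subseteq> J"
    by (auto simp: J_def socle_functional_mult_relator)
  ultimately have "relation_ideal \<subseteq> J"
    by (rule ring.genideal_minimal[OF cring.axioms(1)[OF cring_poly_ring]])
  moreover assume "2 \<in> relation_ideal"
  ultimately have "socle_functional (1 * 2) = 0"
    unfolding J_def by blast
  moreover have "socle_functional 2 = 2"
    by (simp add: socle_functional_def lookup_single when_def exponent_eq_iff lookup_add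
        flip: single_numeral)
  ultimately show False
    by simp
qed

section \<open>The quotient ring in coordinates\<close>

definition residue :: "Z4_XYZ \<Rightarrow> Z4_XYZ set" where
  "residue p = relation_ideal +>\<^bsub>poly_ring_Z4_XYZ\<^esub> p"

lemma cring_R0: "cring R\<^sub>0"
  unfolding R\<^sub>0_def by (rule ideal.quotient_is_cring[OF ideal_relation_ideal cring_poly_ring])

lemma residue_hom: "residue \<in> ring_hom poly_ring_Z4_XYZ R\<^sub>0"
  unfolding R\<^sub>0_def residue_def by (rule ideal.rcos_ring_hom[OF ideal_relation_ideal])

lemma residue_add: "residue (p + q) = residue p \<oplus>\<^bsub>R\<^sub>0\<^esub> residue q"
  using ring_hom_add[OF residue_hom, of p q] by simp

lemma residue_mult: "residue (p * q) = residue p \<otimes>\<^bsub>R\<^sub>0\<^esub> residue q"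
  using ring_hom_mult[OF residue_hom, of p q] by simp

lemma residue_closed: "residue p \<in> carrier R\<^sub>0"
  using ring_hom_closed[OF residue_hom, of p] by simp

lemma residue_surj: "x \<in> carrier R\<^sub>0 \<Longrightarrow> \<exists>p. x = residue p"
  by (auto simp: R\<^sub>0_def residue_def FactRing_def A_RCOSETS_def')

lemma residue_eq_zero_iff: "residue p = \<zero>\<^bsub>R\<^sub>0\<^esub> \<longleftrightarrow> p \<in> relation_ideal"
proof -
  interpret P: cring poly_ring_Z4_XYZ by (rule cring_poly_ring)
  interpret ideal relation_ideal poly_ring_Z4_XYZ by (rule ideal_relation_ideal)
  have "residue p = relation_ideal \<longleftrightarrow> p \<in> relation_ideal"
    unfolding residue_def using a_rcos_self[of p] P.a_coset_join2[OF _ a_subgroup, of p] by auto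
  then show ?thesis
    by (simp add: R\<^sub>0_def FactRing_def)
qed

lemma residue_eqI:
  assumes "p - q \<in> relation_ideal"
  shows "residue p = residue q"
proof -
  interpret R: cring "R\<^sub>0" by (rule cring_R0)
  have "residue p = residue q \<oplus>\<^bsub>R\<^sub>0\<^esub> residue (p - q)"
    by (simp flip: residue_add)
  also have "residue (p - q) = \<zero>\<^bsub>R\<^sub>0\<^esub>"
    using assms by (simp add: residue_eq_zero_iff)
  finally show ?thesis
    by (simp add: residue_closed)
qed

lemma relation_ideal_add: "p \<in> relation_ideal \<Longrightarrow> q \<in> relation_ideal \<Longrightarrow> p + q \<in> relation_ideal"
  using additive_subgroup.a_closed[OF ideal.axioms(1)[OF ideal_relation_ideal]] by simp

lemma relation_ideal_mult: "p \<in> relation_ideal \<Longrightarrow> q * p \<in> relation_ideal"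
  using ideal.I_l_closed[OF ideal_relation_ideal] by simp

lemma relators_subset: "relators \<subseteq> relation_ideal"
  using ring.genideal_self[OF cring.axioms(1)[OF cring_poly_ring]] by simp

text \<open>
  On the residues of \<open>X, Y, Z\<close> the multiplication is the bilinear form with
  \<open>X\<^sup>2 = Y\<^sup>2 = Y Z = 2\<close> and \<open>Z\<^sup>2 = X Y = X Z = 0\<close>. Replacing \<open>Z\<close> by \<open>Y + Z\<close> gives an orthonormal
  basis: \<open>Y (Y + Z) = 4 = 0\<close> and \<open>(Y + Z)\<^sup>2 = Y\<^sup>2 + 2 Y Z + Z\<^sup>2 = 2\<close>.
\<close>

definition normal_form :: "int \<Rightarrow> int \<Rightarrow> int \<Rightarrow> int \<Rightarrow> Z4_XYZ" where
  "normal_form n b c d = of_int n + of_int b * Var 0 + of_int c * Var 1 + of_int d * (Var 1 + Var 2)"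

lemma four_eq_zero: "(4 :: Z4_XYZ) = 0"
proof -
  have "(4 :: Z4_XYZ) = single 0 4"
    by simp
  also have "(4 :: 4) = 0"
    by simp
  finally show ?thesis
    by simp
qed

lemma residue_normal_form_add:
  "residue (normal_form n b c d) \<oplus>\<^bsub>R\<^sub>0\<^esub> residue (normal_form n' b' c' d') = residue (normal_form (n + n') (b + b') (c + c') (d + d'))"
  by (simp add: normal_form_def algebra_simps flip: residue_add)

lemma residue_normal_form_mult:
  "residue (normal_form n b c d) \<otimes>\<^bsub>R\<^sub>0\<^esub> residue (normal_form n' b' c' d') =
    residue (normal_form (n * n' + 2 * (b * b' + c * c' + d * d'))
      (n * b' + n' * b) (n * c' + n' * c) (n * d' + n' * d))"
proof -
  define x y z where xyz: "x = Var 0" "y = Var 1" "z = Var 2"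
  have rels: "x\<^sup>2 - 2 \<in> relation_ideal" "y\<^sup>2 - 2 \<in> relation_ideal" "z\<^sup>2 \<in> relation_ideal"
    "2 * y \<in> relation_ideal"
    "x * y \<in> relation_ideal" "x * z \<in> relation_ideal" "y * z - 2 \<in> relation_ideal"
    using relators_subset by (auto simp: relators_def Let_def xyz)
  let ?i = "of_int :: int \<Rightarrow> Z4_XYZ"
  \<comment> \<open>The difference of both sides, written as a combination of the relators and of 4.\<close>
  have "normal_form n b c d * normal_form n' b' c' d' -
      normal_form (n * n' + 2 * (b * b' + c * c' + d * d')) (n * b' + n' * b) (n * c' + n' * c) (n * d' + n' * d)
    = ?i (b * b') * (x\<^sup>2 - 2)
    + ?i (c * c' + d * d' + c * d' + c' * d) * (y\<^sup>2 - 2)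
    + ?i (d * d') * z\<^sup>2
    + (?i (d * d') * z) * (2 * y)
    + ?i (b * c' + b' * c + b * d' + b' * d) * (x * y)
    + ?i (b * d' + b' * d) * (x * z)
    + ?i (c * d' + c' * d) * (y * z - 2)
    + ?i (c * d' + c' * d) * 4"
    unfolding normal_form_def xyz[symmetric] by (simp add: algebra_simps power2_eq_square)
  also have "\<dots> \<in> relation_ideal"
    unfolding four_eq_zero by (simp add: relation_ideal_add relation_ideal_mult rels)
  finally show ?thesis
    by (simp add: residue_eqI flip: residue_mult)
qed

lemma residue_normal_form_surj: "\<exists>n b c d. residue p = residue (normal_form n b c d)"
proof (induction p rule: Z4_XYZ_induct)
  case (const n)
  have "of_int n = normal_form n 0 0 0"
    by (simp add: normal_form_def)
  then show ?case by metis
next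
  case (Var i)
  \<comment> \<open>In the basis X, Y, Y + Z the variable Z has coordinates 0, -1, 1.\<close>
  have "Var 0 = normal_form 0 1 0 0" "Var 1 = normal_form 0 0 1 0" "Var 2 = normal_form 0 0 (- 1) 1"
    by (simp_all add: normal_form_def)
  moreover have "i = 0 \<or> i = 1 \<or> i = 2"
    by (rule three_cases)
  ultimately show ?case by metis
next
  case (add p q)
  then show ?case
    unfolding residue_add using residue_normal_form_add by metis
next
  case (mult p q)
  then show ?case
    unfolding residue_mult using residue_normal_form_mult by metis
qed

lemma residue_normal_form_eq_zeroI:
  assumes "4 dvd n" "even b" "even c" "even d"
  shows "residue (normal_form n b c d) = \<zero>\<^bsub>R\<^sub>0\<^esub>"
proof -
  obtain n' b' c' d' where [simp]: "n = 4 * n'" "b = 2 * b'" "c = 2 * c'" "d = 2 * d'"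
    using assms by (auto elim!: dvdE)
  have rels: "2 * Var 0 \<in> relation_ideal" "2 * Var 1 \<in> relation_ideal" "2 * Var 2 \<in> relation_ideal"
    using relators_subset by (auto simp: relators_def Let_def)
  have "normal_form n b c d = of_int n' * 4 + of_int b' * (2 * Var 0) + of_int (c' + d') * (2 * Var 1)
      + of_int d' * (2 * Var 2)"
    by (simp add: normal_form_def algebra_simps)
  also have "\<dots> \<in> relation_ideal"
    unfolding four_eq_zero by (simp add: relation_ideal_add relation_ideal_mult rels)
  finally show ?thesis
    by (simp add: residue_eq_zero_iff)
qed

text \<open>
  For the nontrivial direction, multiplying by 2 and by the three basis elements moves each
  coordinate into the socle, where \<open>2 k = 0\<close> forces \<open>k\<close> to be even since 2 is nonzero.
\<close>

lemma residue_normal_form_eq_zero_iff: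
  "residue (normal_form n b c d) = \<zero>\<^bsub>R\<^sub>0\<^esub> \<longleftrightarrow> 4 dvd n \<and> even b \<and> even c \<and> even d"
proof
  interpret R: cring "R\<^sub>0" by (rule cring_R0)
  assume zero: "residue (normal_form n b c d) = \<zero>\<^bsub>R\<^sub>0\<^esub>"
  \<comment> \<open>An odd k would make twice k equal to 2, up to terms that vanish.\<close>
  have even: "even k" if "residue (normal_form (2 * k) l l' l'') = \<zero>\<^bsub>R\<^sub>0\<^esub>" "even l" "even l'" "even l''" for k l l' l''
  proof (rule ccontr)
    assume "odd k"
    then have "4 dvd 2 - 2 * k"
      by presburger
    then have "residue (normal_form (2 - 2 * k) (- l) (- l') (- l'')) = \<zero>\<^bsub>R\<^sub>0\<^esub>"
      using that by (intro residue_normal_form_eq_zeroI) auto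
    then have "residue (normal_form 2 0 0 0) = \<zero>\<^bsub>R\<^sub>0\<^esub>"
      using residue_normal_form_add[of "2 * k" l l' l'' "2 - 2 * k" "- l" "- l'" "- l''"] that(1) by simp
    then show False
      using two_notin_relation_ideal by (simp add: residue_eq_zero_iff normal_form_def)
  qed
  have mult: "residue (normal_form (n * n' + 2 * (b * b' + c * c' + d * d'))
      (n * b' + n' * b) (n * c' + n' * c) (n * d' + n' * d)) = \<zero>\<^bsub>R\<^sub>0\<^esub>" for n' b' c' d'
    using residue_normal_form_mult[of n b c d n' b' c' d'] by (simp add: zero residue_closed)
  have "even n"
    using even[of n "2 * b" "2 * c" "2 * d"] mult[of 2 0 0 0] by (simp add: mult.commute)
  moreover from this have bcd: "even b" "even c" "even d"
    using even[of b n 0 0] mult[of 0 1 0 0] even[of c 0 n 0] mult[of 0 0 1 0]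
      even[of d 0 0 n] mult[of 0 0 0 1] by simp_all
  moreover have "even (n div 2)"
    using even[of "n div 2" b c d] zero \<open>even n\<close> bcd by simp
  ultimately show "4 dvd n \<and> even b \<and> even c \<and> even d"
    by (auto elim!: evenE)
qed (simp add: residue_normal_form_eq_zeroI)

lemma dot_product_ring_R0: "dot_product_ring R\<^sub>0 (\<lambda>n b c d. residue (normal_form n b c d))"
proof (intro dot_product_ring.intro dot_product_ring_axioms.intro)
  show "\<exists>n b c d. x = residue (normal_form n b c d)" if "x \<in> carrier R\<^sub>0" for x
    using residue_surj[OF that] residue_normal_form_surj by metis
qed (simp_all add: cring_R0 residue_closed residue_normal_form_add residue_normal_form_mult
    residue_normal_form_eq_zero_iff)

theorem proposition2p1:
  shows "chromatic_number (AG R\<^sub>0) = clique_number (AG R\<^sub>0) \<and> clique_number (AG R\<^sub>0) = 4"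
proof -
  interpret dot_product_ring "R\<^sub>0" "\<lambda>n b c d. residue (normal_form n b c d)"
    by (rule dot_product_ring_R0)
  show ?thesis
    using clique_number_le_chromatic_number[of "AG R\<^sub>0"] chromatic_number_le_4 clique_number_ge_4
    by (metis order.antisym order.trans)
qed

end
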